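(* Let $N,K\ge1$ and $1\le M\le T$ be integers and consider a network of $N$ individuals with bot set $\mathcal B=\{B_1,\dots,B_K\}$, bot $B_k$ having strength $\eta_{B_k}\in(0,1]$. Let $\widetilde S_N=[\widetilde s_{ij}]_{i,j=1}^N$ and the $N\times K$ matrix $\widetilde S_{\mathcal B}=[\widetilde s_{iB_k}]$ have nonnegative entries with $\sum_{j=1}^N\widetilde s_{ij}+\sum_{k=1}^K\widetilde s_{iB_k}=1$ for all $i\in\{1,\dots,N\}$, and let the full interaction matrix be $\begin{bmatrix}\widetilde S_N&\widetilde S_{\mathcal B}\\ 0_{K\times N}&I_{K\times K}\end{bmatrix}$. Assume the network is connected and every bot influences at least one individual (for each $k$ there is $i$ with $\widetilde s_{iB_k}>0$). Let $c_{2,M}\in(-1/M,1/M)\setminus\{0\}$, let $c_{1,M}$ satisfy $\max(0,-c_{2,M}m)\le c_{1,M}\le\min(1,1-c_{2,M}m)$ for all $m\in\{0,\dots,M\}$, and let the memory sets be $\mathcal M_{ji}^{(t)}=\{t-k_{ji}^{(1)},\dots,t-k_{ji}^{(M)}\}$ with integers $1\le k_{ji}^{(1)}<\cdots<k_{ji}^{(M)}\le T$ for all $i,j\in\{1,\dots,N\}$. Put $p^{( * )}=c_{1,M}/(1-c_{2,M}M)$ and $\boldsymbol\eta_{p^{( * )}}:=[\eta_{B_1}-p^{( * )},\dots,\eta_{B_K}-p^{( * )}]^{\mathbf T}$. Suppose $\widetilde S_{\mathcal B}\,\boldsymbol\eta_{p^{( * )}}=\mathbf 0_N$ with $\eta_{B_k}\neq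 p^{( * )}$ for at least one $k$. Then there exist indices $k_1,k_2\in\{1,\dots,K\}$ such that $\eta_{B_{k_1}}<p^{( * )}$ and $\eta_{B_{k_2}}>p^{( * )}$.
   Context: $\mathbf 0_N$ is the all-zeros column vector of length $N$. $\widetilde s_{ij}$ is the influence weight of individual $j$ on individual $i$ and $\widetilde s_{iB_k}$ the influence weight of bot $B_k$ on individual $i$. "Connected" means that the underlying undirected graph on individuals and bots (edge from $j$ to $i$ iff $\widetilde s_{ij}>0$, from $B_k$ to $i$ iff $\widetilde s_{iB_k}>0$) is connected. The memory set $\mathcal M_{ji}^{(t)}$ is the set of past times whose opinions of $j$ are remembered by $i$ at time $t$; the value $p^{( * )}$ is the common entry of the fixed point $p^{( * )}\mathbf 1_N$ of the belief dynamics of the network without bots. *)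

theory Defs
  imports
    "HOL-Analysis.Analysis"
    "Graph_Theory.Digraph_Component"
begin

text \<open>
  The finite types \<open>'n\<close> and \<open>'b\<close> index the \<open>N = CARD('n) \<ge> 1\<close> individuals and the
  \<open>K = CARD('b) \<ge> 1\<close> bots; in \<open>'n + 'b\<close>, \<open>Inl i\<close> is an individual and \<open>Inr k\<close> a bot.
\<close>

definition full_interaction_matrix ::
    "real ^ 'n::finite ^ 'n \<Rightarrow> real ^ 'b::finite ^ 'n \<Rightarrow> real ^ ('n + 'b) ^ ('n + 'b)" where
  "full_interaction_matrix SN SB = (\<chi> u v.
     case u of
       Inl i \<Rightarrow> (case v of Inl j \<Rightarrow> SN $ i $ j | Inr k \<Rightarrow> SB $ i $ k)
     | Inr k \<Rightarrow> (case v of Inl j \<Rightarrow> 0 | Inr l \<Rightarrow> (if k = l then 1 else 0)))"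

text \<open>
  An arc \<open>(v, u)\<close> points from the influencing \<open>v\<close> to the influenced \<open>u\<close>. Only arcs into
  individuals are drawn; the identity block of the matrix gives no arcs.
\<close>

definition influence_graph ::
    "real ^ ('n::finite + 'b::finite) ^ ('n + 'b) \<Rightarrow> ('n + 'b) pair_pre_digraph" where
  "influence_graph S = \<lparr> pverts = UNIV, parcs = {(v, Inl i) | v i. S $ Inl i $ v > 0} \<rparr>"

text \<open>
  Times are integers, so that \<open>t - k\<close> is not truncated.
  The delays \<open>k 1, \<dots>, k M\<close> do not depend on \<open>t\<close>.
\<close>

definition delayed_times :: "nat \<Rightarrow> (nat \<Rightarrow> nat) \<Rightarrow> int \<Rightarrow> int set" where
  "delayed_times M k t = {t - int (k r) | r. r \<in> {1..M}}"

end

theory Submission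
  imports Defs
begin

text \<open>Let x be the vector of deviations of the bot strengths from \<open>p\<close>. If no
  deviation were negative, each row of the balance equation would be a vanishing sum of nonnegative
  terms, so every term would be zero. Each bot has positive weight in some row, so every deviation
  would be zero, against \<open>not_all_equal\<close>. Hence some bot lies below \<open>p\<close>.
  The argument, isolated in \<open>nonneg_matrix_kernel_has_neg_entry\<close>, applies equally to -x
  and so gives a bot above \<open>p\<close>.\<close>

lemma nonneg_matrix_kernel_has_neg_entry:
  fixes A :: "'a::linordered_idom ^ 'b::finite ^ 'n" and x :: "'a ^ 'b"
  assumes nonneg: "\<forall>i b. 0 \<le> A $ i $ b"
    and col_pos: "\<forall>b. \<exists>i. A $ i $ b > 0"
    and kernel: "A *v x = 0"
    and nonzero: "x \<noteq> 0"
  shows "\<exists>b. x $ b < 0"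
proof (rule ccontr)
  assume "\<not> (\<exists>b. x $ b < 0)"
  then have x_nonneg: "\<And>b. 0 \<le> x $ b"
    by (simp add: not_less)
  have "x $ b = 0" for b
  proof -
    obtain i where i: "A $ i $ b > 0"
      using col_pos by blast
    \<comment> \<open>Row \<open>i\<close> was chosen so that the fixed \<open>b\<close> has a
      positive coefficient; the summation index shadows that \<open>b\<close>.\<close>
    have "(\<Sum>b\<in>UNIV. A $ i $ b * x $ b) = 0"
      using arg_cong[OF kernel, of "\<lambda>v. v $ i"] by (simp add: matrix_vector_mult_def)
    then have "A $ i $ b * x $ b = 0"
      using nonneg x_nonneg by (subst (asm) sum_nonneg_eq_0_iff) auto
    with i show ?thesis
      by simp
  qed
  with nonzero show False
    by (simp add: vec_eq_iff)
qed

theorem corollary1: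
  fixes M T :: nat
    and \<eta> :: "real ^ 'b::finite"
    and SN :: "real ^ 'n::finite ^ 'n"
    and SB :: "real ^ 'b ^ 'n"
    and S :: "real ^ ('n + 'b) ^ ('n + 'b)"
    and c1 c2 p :: real
    and k :: "'n \<Rightarrow> 'n \<Rightarrow> nat \<Rightarrow> nat"
    and Mem :: "'n \<Rightarrow> 'n \<Rightarrow> int \<Rightarrow> int set"
  assumes M_T: "1 \<le> M" "M \<le> T"
    and bot_strength: "\<forall>b. 0 < \<eta> $ b \<and> \<eta> $ b \<le> 1"
    and SN_nonneg: "\<forall>i j. 0 \<le> SN $ i $ j"
    and SB_nonneg: "\<forall>i b. 0 \<le> SB $ i $ b"
    and row_sums: "\<forall>i. (\<Sum>j\<in>UNIV. SN $ i $ j) + (\<Sum>b\<in>UNIV. SB $ i $ b) = 1"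
    and S_eq: "S = full_interaction_matrix SN SB"
    and network_connected: "Digraph_Component.connected (with_proj (influence_graph S))"
    and bots_influence: "\<forall>b. \<exists>i. SB $ i $ b > 0"
    and c2_range: "- 1 / real M < c2" "c2 < 1 / real M" "c2 \<noteq> 0"
    and c1_range: "\<forall>m\<in>{0..M}. max 0 (- c2 * real m) \<le> c1 \<and> c1 \<le> min 1 (1 - c2 * real m)"
    and delays_increasing: "\<forall>j i. strict_mono_on {1..M} (k j i)"
    and delays_range: "\<forall>j i. \<forall>r\<in>{1..M}. 1 \<le> k j i r \<and> k j i r \<le> T"
    and memory_sets: "\<forall>j i t. Mem j i t = delayed_times M (k j i) t"
    and p_eq: "p = c1 / (1 - c2 * real M)"
    and balance: "SB *v (\<chi> b. \<eta> $ b - p) = 0"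
    and not_all_equal: "\<exists>b. \<eta> $ b \<noteq> p"
  shows "\<exists>b1 b2. \<eta> $ b1 < p \<and> \<eta> $ b2 > p"
proof -
  define x where "x = (\<chi> b. \<eta> $ b - p)"
  have x: "SB *v x = 0" "x \<noteq> 0"
    using balance not_all_equal by (auto simp: x_def vec_eq_iff)
  \<comment> \<open>The kernel is closed under negation, and a negative entry of \<open>- x\<close>
    is a bot whose strength exceeds \<open>p\<close>.\<close>
  then have neg: "SB *v (- x) = 0" "- x \<noteq> 0"
    by (auto simp: matrix_vector_mult_def vec_eq_iff sum_negf)
  note has_neg = nonneg_matrix_kernel_has_neg_entry[OF SB_nonneg bots_influence]
  show ?thesis
    using has_neg[OF x] has_neg[OF neg] by (simp add: x_def)
qed

end
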